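(* Let $(A,p_l)$ be a self-induced Fréchet algebra and let $n\in\mathbb{N}$. If $A$ is $2n$-weakly amenable, then $A^{\#}$ is $2n$-weakly amenable.
   Context: All spaces are complex and $\mathbb{N}=\{1,2,\dots\}$. A Fréchet algebra $(A,p_l)$ is an algebra that is complete and Hausdorff for the topology generated by a separating, increasing sequence $(p_l)_{l\in\mathbb{N}}$ of submultiplicative seminorms. The unitization of $A$ is $A^{\#}=A\oplus\mathbb{C}e$ with product $(a,\lambda)(b,\mu)=(ab+\mu a+\lambda b,\lambda\mu)$ and seminorms $q_l(a,\lambda)=p_l(a)+|\lambda|$; it is a Fréchet algebra with identity $e=(0,1)$. For a locally convex space $X$, $X^*$ is its continuous dual with the strong topology (uniform convergence on bounded subsets of $X$); $X^{(0)}=X$ and $X^{(n)}=(X^{(n-1)})^*$. If $B$ is a Fréchet algebra and $X$ a locally convex $B$-bimodule, then $X^*$ is a $B$-bimodule via $\langle b\cdot f,x\rangle=\langle f,x\cdot b\rangle$ and $\langle f\cdot b,x\rangle=\langle f,b\cdot x\rangle$; iterating, every $X^{(n)}$ is a $B$-bimodule. $B$ is a bimodule over itself by multiplication. A continuous derivation $D:B\to X$ is a continuous linear map with $D(ab)=a\cdot D(b)+D(a)\cdot b$ for all $a,b\in B$; it is inner if there is $x\in X$ with $D(b)=b\cdot x-x\cdot b$ for all $b\in B$. $B$ is $n$-weakly amenable if every continuous derivation $B\to B^{(n)}$ is inner. A Fréchet algebra $B$ is self-induced if (i) $\overline{B^2}=B$, where $B^2$ is the linear span of all products $ab$ with $a,b\in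 B$, and (ii) every continuous balanced bilinear map $\varphi:B\times B\to\mathbb{C}$ (balanced: $\varphi(ac,b)=\varphi(a,cb)$ for all $a,b,c\in B$) has the form $\varphi(a,b)=f(ab)$ for some $f\in B^*$. *)

theory Defs
  imports "HOL-Analysis.Analysis"
begin

section \<open>Locally convex spaces and their strong duals\<close>

text \<open>
  A complex locally convex space on a subset of a type, its topology given by a set of
  seminorms. Only the values of the operations and of the seminorms on the carrier matter.
\<close>

record 'x lcs =
  vcarrier :: "'x set"
  vadd :: "'x \<Rightarrow> 'x \<Rightarrow> 'x"
  vscale :: "complex \<Rightarrow> 'x \<Rightarrow> 'x"
  seminorms :: "('x \<Rightarrow> real) set"

definition vdiff :: "('x, 'm) lcs_scheme \<Rightarrow> 'x \<Rightarrow> 'x \<Rightarrow> 'x" where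
  "vdiff X x y = vadd X x (vscale X (-1) y)"

text \<open>The carrier is inserted so that it is the whole space even if there are no seminorms.\<close>

definition lc_topology :: "('x, 'm) lcs_scheme \<Rightarrow> 'x topology" where
  "lc_topology X = topology_generated_by (insert (vcarrier X)
     {{y \<in> vcarrier X. p (vdiff X y x) < e} | p x e.
        p \<in> seminorms X \<and> x \<in> vcarrier X \<and> e > 0})"

definition bounded_in :: "('x, 'm) lcs_scheme \<Rightarrow> 'x set \<Rightarrow> bool" where
  "bounded_in X S \<longleftrightarrow> S \<subseteq> vcarrier X \<and> (\<forall>p\<in>seminorms X. bdd_above (p ` S))"

text \<open>
  Functionals are represented by functions on the whole type that vanish off the carrier, so
  that equal functionals are equal functions.
\<close>

definition continuous_dual :: "('x, 'm) lcs_scheme \<Rightarrow> ('x \<Rightarrow> complex) set" where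
  "continuous_dual X = {f.
     (\<forall>x\<in>vcarrier X. \<forall>y\<in>vcarrier X. f (vadd X x y) = f x + f y) \<and>
     (\<forall>c. \<forall>x\<in>vcarrier X. f (vscale X c x) = c * f x) \<and>
     continuous_map (lc_topology X) euclidean f \<and>
     (\<forall>x. x \<notin> vcarrier X \<longrightarrow> f x = 0)}"

text \<open>
  Bimodules over an algebra with elements of type \<open>'b\<close>; the strong dual carries the topology
  of uniform convergence on bounded sets and the dual bimodule actions.
\<close>

record ('b, 'x) bimodule = "'x lcs" +
  lact :: "'b \<Rightarrow> 'x \<Rightarrow> 'x"
  ract :: "'x \<Rightarrow> 'b \<Rightarrow> 'x"

definition strong_dual :: "('b, 'x) bimodule \<Rightarrow> ('b, 'x \<Rightarrow> complex) bimodule" where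
  "strong_dual X =
     \<lparr> vcarrier = continuous_dual X,
       vadd = (\<lambda>f g x. f x + g x),
       vscale = (\<lambda>c f x. c * f x),
       seminorms = {(\<lambda>f. SUP x\<in>S. cmod (f x)) | S. bounded_in X S \<and> S \<noteq> {}},
       lact = (\<lambda>b f x. if x \<in> vcarrier X then f (ract X x b) else 0),
       ract = (\<lambda>f b x. if x \<in> vcarrier X then f (lact X b x) else 0) \<rparr>"


section \<open>Iterated duals\<close>

text \<open>
  The type of the \<open>n\<close>-th dual, formed by iterating \<open>strong_dual\<close>, depends on \<open>n\<close>, and for
  cardinality reasons no single HOL type can host all the iterated duals of a given space. The
  duals up to order \<open>n\<close> are therefore copied into a type \<open>'u\<close>: \<open>j\<close> names the elements of the
  space itself, and \<open>c i\<close> names the functionals on the (copied) \<open>i\<close>-th dual. The maps have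
  to be injective where they are used (\<open>faithful_coding\<close>); then the construction yields the
  iterated dual up to isomorphism. For every \<open>n\<close> there is a type \<open>'u\<close> admitting such maps;
  see the lemmas \<open>universal_coding_0\<close>, \<open>universal_coding_Suc\<close> and
  \<open>universal_coding_faithful\<close> below.
\<close>

definition transport :: "('x \<Rightarrow> 'u) \<Rightarrow> ('b, 'x) bimodule \<Rightarrow> ('b, 'u) bimodule" where
  "transport g X = (let h = inv_into (vcarrier X) g in
     \<lparr> vcarrier = g ` vcarrier X,
       vadd = (\<lambda>u v. g (vadd X (h u) (h v))),
       vscale = (\<lambda>c u. g (vscale X c (h u))),
       seminorms = (\<lambda>p. p \<circ> h) ` seminorms X,
       lact = (\<lambda>b u. g (lact X b (h u))),
       ract = (\<lambda>u b. g (ract X (h u) b)) \<rparr>)"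

primrec iterated_dual ::
  "('x \<Rightarrow> 'u) \<Rightarrow> (nat \<Rightarrow> ('u \<Rightarrow> complex) \<Rightarrow> 'u) \<Rightarrow> ('b, 'x) bimodule \<Rightarrow> nat \<Rightarrow> ('b, 'u) bimodule"
where
  "iterated_dual j c X 0 = transport j X"
| "iterated_dual j c X (Suc n) = transport (c n) (strong_dual (iterated_dual j c X n))"

definition faithful_coding ::
  "('x \<Rightarrow> 'u) \<Rightarrow> (nat \<Rightarrow> ('u \<Rightarrow> complex) \<Rightarrow> 'u) \<Rightarrow> ('b, 'x) bimodule \<Rightarrow> nat \<Rightarrow> bool"
where
  "faithful_coding j c X n \<longleftrightarrow> inj_on j (vcarrier X) \<and>
     (\<forall>i<n. inj_on (c i) (continuous_dual (iterated_dual j c X i)))"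

definition universal_coding ::
  "('x \<Rightarrow> 'u) \<Rightarrow> (nat \<Rightarrow> ('u \<Rightarrow> complex) \<Rightarrow> 'u) \<Rightarrow> nat \<Rightarrow> bool"
where
  "universal_coding j c n \<longleftrightarrow> inj j \<and>
     (\<exists>S. range j \<subseteq> S 0 \<and>
       (\<forall>i<n. inj_on (c i) {f. \<forall>x. x \<notin> S i \<longrightarrow> f x = 0} \<and>
              c i ` {f. \<forall>x. x \<notin> S i \<longrightarrow> f x = 0} \<subseteq> S (Suc i)))"

lemma universal_coding_0: "universal_coding id c 0"
  by (auto simp: universal_coding_def)

lemma universal_coding_Suc:
  fixes j :: "'x \<Rightarrow> 'u" and c :: "nat \<Rightarrow> ('u \<Rightarrow> complex) \<Rightarrow> 'u"
  assumes "universal_coding j c n"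
  shows "\<exists>(j' :: 'x \<Rightarrow> 'u + ('u \<Rightarrow> complex)) c'. universal_coding j' c' (Suc n)"
proof -
  obtain S where inj: "inj j" and S0: "range j \<subseteq> S 0"
    and inj_c: "\<And>i. i < n \<Longrightarrow> inj_on (c i) {f. \<forall>x. x \<notin> S i \<longrightarrow> f x = 0}"
    and sub: "\<And>i. i < n \<Longrightarrow> c i ` {f. \<forall>x. x \<notin> S i \<longrightarrow> f x = 0} \<subseteq> S (Suc i)"
    using assms by (auto simp: universal_coding_def)
  define j' :: "'x \<Rightarrow> 'u + ('u \<Rightarrow> complex)" where "j' = Inl \<circ> j"
  define c' :: "nat \<Rightarrow> ('u + ('u \<Rightarrow> complex) \<Rightarrow> complex) \<Rightarrow> 'u + ('u \<Rightarrow> complex)"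
    where "c' = (\<lambda>i f. if i < n then Inl (c i (f \<circ> Inl)) else Inr (f \<circ> Inl))"
  define T :: "nat \<Rightarrow> ('u + ('u \<Rightarrow> complex)) set"
    where "T = (\<lambda>i. if i \<le> n then Inl ` S i else UNIV)"
  have eq: "f = g" if "f \<circ> Inl = g \<circ> Inl" "\<forall>x. x \<notin> T i \<longrightarrow> f x = 0" "\<forall>x. x \<notin> T i \<longrightarrow> g x = 0" "i \<le> n"
    for f g :: "'u + ('u \<Rightarrow> complex) \<Rightarrow> complex" and i
  proof
    fix x show "f x = g x"
      using that by (cases x) (auto simp: T_def fun_eq_iff image_iff)
  qed
  have vanish: "f \<circ> Inl \<in> {f. \<forall>x. x \<notin> S i \<longrightarrow> f x = 0}" if "\<forall>x. x \<notin> T i \<longrightarrow> f x = 0" "i \<le> n"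
    for f :: "'u + ('u \<Rightarrow> complex) \<Rightarrow> complex" and i
    using that by (auto simp: T_def)
  have "inj_on (c' i) {f. \<forall>x. x \<notin> T i \<longrightarrow> f x = 0}" if "i < Suc n" for i
  proof (rule inj_onI)
    fix f g assume fg: "f \<in> {f. \<forall>x. x \<notin> T i \<longrightarrow> f x = 0}" "g \<in> {f. \<forall>x. x \<notin> T i \<longrightarrow> f x = 0}"
      and e: "c' i f = c' i g"
    have "f \<circ> Inl = g \<circ> Inl"
    proof (cases "i < n")
      case True
      then have "c i (f \<circ> Inl) = c i (g \<circ> Inl)" using e by (simp add: c'_def)
      moreover have "f \<circ> Inl \<in> {f. \<forall>x. x \<notin> S i \<longrightarrow> f x = 0}" "g \<circ> Inl \<in> {f. \<forall>x. x \<notin> S i \<longrightarrow> f x = 0}"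
        using vanish[of i f] vanish[of i g] fg True by simp_all
      ultimately show ?thesis by (rule inj_onD[OF inj_c[OF True]])
    next
      case False
      then show ?thesis using e by (simp add: c'_def)
    qed
    then show "f = g" using eq[of f g i] fg that by auto
  qed
  moreover have "c' i ` {f. \<forall>x. x \<notin> T i \<longrightarrow> f x = 0} \<subseteq> T (Suc i)" if "i < Suc n" for i
  proof (cases "i < n")
    case True
    have "c i (f \<circ> Inl) \<in> S (Suc i)" if "\<forall>x. x \<notin> T i \<longrightarrow> f x = 0" for f
      by (rule subsetD[OF sub[OF True] imageI[OF vanish[OF that]]]) (use True in simp)
    then show ?thesis using True by (auto simp: c'_def T_def)
  next
    case False
    then show ?thesis by (simp add: T_def)
  qed
  moreover have "inj j'" using inj by (auto simp: j'_def inj_def)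
  moreover have "range j' \<subseteq> T 0" using S0 by (auto simp: j'_def T_def)
  ultimately have "universal_coding j' c' (Suc n)"
    unfolding universal_coding_def by (intro conjI exI[of _ T] allI impI)
  then show ?thesis by (intro exI)
qed

lemma universal_coding_faithful:
  fixes j :: "'x \<Rightarrow> 'u" and c :: "nat \<Rightarrow> ('u \<Rightarrow> complex) \<Rightarrow> 'u" and X :: "('b, 'x) bimodule"
  assumes "universal_coding j c n"
  shows "faithful_coding j c X n"
proof -
  obtain S where inj: "inj j" and S0: "range j \<subseteq> S 0"
    and inj_c: "\<And>i. i < n \<Longrightarrow> inj_on (c i) {f. \<forall>x. x \<notin> S i \<longrightarrow> f x = 0}"
    and sub: "\<And>i. i < n \<Longrightarrow> c i ` {f. \<forall>x. x \<notin> S i \<longrightarrow> f x = 0} \<subseteq> S (Suc i)"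
    using assms by (auto simp: universal_coding_def)
  have vanish: "continuous_dual Y \<subseteq> {f. \<forall>x. x \<notin> S i \<longrightarrow> f x = 0}"
    if "vcarrier Y \<subseteq> S i" for Y :: "('b, 'u) bimodule" and i
    using that by (auto simp: continuous_dual_def)
  have carr: "vcarrier (iterated_dual j c X i) \<subseteq> S i" if "i \<le> n" for i
    using that
  proof (induction i)
    case 0
    then show ?case using S0 by (auto simp: transport_def Let_def)
  next
    case (Suc i)
    then have "i < n" "vcarrier (iterated_dual j c X i) \<subseteq> S i" by simp_all
    then have "c i ` continuous_dual (iterated_dual j c X i) \<subseteq> S (Suc i)"
      by (rule_tac subset_trans[OF image_mono[OF vanish] sub])
    then show ?case by (simp add: transport_def Let_def strong_dual_def)
  qed
  have "inj_on (c i) (continuous_dual (iterated_dual j c X i))" if "i < n" for i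
    by (rule inj_on_subset[OF inj_c[OF that] vanish[OF carr]]) (use that in simp)
  moreover have "inj_on j (vcarrier X)" using inj by (rule inj_on_subset) simp
  ultimately show ?thesis by (simp add: faithful_coding_def)
qed


section \<open>Frechet algebras\<close>

text \<open>The seminorms are indexed from \<open>0\<close>.\<close>

record 'a seminormed_algebra =
  scl :: "complex \<Rightarrow> 'a \<Rightarrow> 'a"
  mul :: "'a \<Rightarrow> 'a \<Rightarrow> 'a"
  sn :: "nat \<Rightarrow> 'a \<Rightarrow> real"

definition regular_bimodule ::
  "'a::ab_group_add seminormed_algebra \<Rightarrow> ('a, 'a) bimodule" where
  "regular_bimodule A =
     \<lparr> vcarrier = UNIV, vadd = (+), vscale = scl A, seminorms = range (sn A),
       lact = mul A, ract = mul A \<rparr>"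

abbreviation alg_topology :: "'a::ab_group_add seminormed_algebra \<Rightarrow> 'a topology" where
  "alg_topology A \<equiv> lc_topology (regular_bimodule A)"

text \<open>
  Hausdorffness is \<open>separating\<close>. The topology is metrizable, so completeness is stated with
  sequences.
\<close>

locale frechet_algebra = vector_space "scl A" for A :: "'a::ab_group_add seminormed_algebra" +
  assumes mul_assoc: "mul A (mul A a b) d = mul A a (mul A b d)"
    and mul_add_left: "mul A (a + b) d = mul A a d + mul A b d"
    and mul_add_right: "mul A a (b + d) = mul A a b + mul A a d"
    and mul_scl_left: "mul A (scl A z a) b = scl A z (mul A a b)"
    and mul_scl_right: "mul A a (scl A z b) = scl A z (mul A a b)"
    and sn_triangle: "sn A l (a + b) \<le> sn A l a + sn A l b"
    and sn_scl: "sn A l (scl A z a) = cmod z * sn A l a"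
    and submultiplicative: "sn A l (mul A a b) \<le> sn A l a * sn A l b"
    and increasing: "sn A l a \<le> sn A (Suc l) a"
    and separating: "(\<forall>l. sn A l a = 0) \<Longrightarrow> a = 0"
    and complete: "(\<forall>l. \<forall>e>0. \<exists>N. \<forall>i\<ge>N. \<forall>k\<ge>N. sn A l (x i - x k) < e) \<Longrightarrow>
                     \<exists>a. limitin (alg_topology A) x a sequentially"

definition unitization ::
  "'a::ab_group_add seminormed_algebra \<Rightarrow> ('a \<times> complex) seminormed_algebra" where
  "unitization A =
     \<lparr> scl = (\<lambda>z (a, s). (scl A z a, z * s)),
       mul = (\<lambda>(a, s) (b, t). (mul A a b + scl A t a + scl A s b, s * t)),
       sn = (\<lambda>l (a, s). sn A l a + cmod s) \<rparr>"

definition self_induced :: "'a::ab_group_add seminormed_algebra \<Rightarrow> bool" where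
  "self_induced A \<longleftrightarrow>
     alg_topology A closure_of (module.span (scl A) {mul A a b | a b. True}) = UNIV \<and>
     (\<forall>\<phi>. (\<forall>a. Vector_Spaces.linear (scl A) (*) (\<lambda>b. \<phi> a b)) \<and>
          (\<forall>b. Vector_Spaces.linear (scl A) (*) (\<lambda>a. \<phi> a b)) \<and>
          continuous_map (prod_topology (alg_topology A) (alg_topology A)) euclidean
            (\<lambda>(a, b). \<phi> a b) \<and>
          (\<forall>a b d. \<phi> (mul A a d) b = \<phi> a (mul A d b))
        \<longrightarrow> (\<exists>f\<in>continuous_dual (regular_bimodule A). \<forall>a b. \<phi> a b = f (mul A a b)))"


section \<open>Weak amenability\<close>

definition continuous_derivation ::
  "'a::ab_group_add seminormed_algebra \<Rightarrow> ('a, 'x) bimodule \<Rightarrow> ('a \<Rightarrow> 'x) \<Rightarrow> bool" where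
  "continuous_derivation A X D \<longleftrightarrow>
     range D \<subseteq> vcarrier X \<and>
     (\<forall>a b. D (a + b) = vadd X (D a) (D b)) \<and>
     (\<forall>z a. D (scl A z a) = vscale X z (D a)) \<and>
     continuous_map (alg_topology A) (lc_topology X) D \<and>
     (\<forall>a b. D (mul A a b) = vadd X (lact X a (D b)) (ract X (D a) b))"

definition inner_derivation :: "('a, 'x) bimodule \<Rightarrow> ('a \<Rightarrow> 'x) \<Rightarrow> bool" where
  "inner_derivation X D \<longleftrightarrow> (\<exists>x\<in>vcarrier X. \<forall>a. D a = vdiff X (lact X a x) (ract X x a))"

text \<open>
  Meaningful for \<open>faithful_coding j c (regular_bimodule A) n\<close>, and then independent of the
  coding \<open>j\<close>, \<open>c\<close>.
\<close>

definition weakly_amenable ::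
  "('a \<Rightarrow> 'u) \<Rightarrow> (nat \<Rightarrow> ('u \<Rightarrow> complex) \<Rightarrow> 'u) \<Rightarrow> nat \<Rightarrow>
   'a::ab_group_add seminormed_algebra \<Rightarrow> bool"
where
  "weakly_amenable j c n A \<longleftrightarrow>
     (\<forall>D. continuous_derivation A (iterated_dual j c (regular_bimodule A) n) D \<longrightarrow>
          inner_derivation (iterated_dual j c (regular_bimodule A) n) D)"

end

theory Submission imports Defs begin

text \<open>
  Every iterated dual of \<open>A\<^sup>#\<close> is the corresponding dual of \<open>A\<close> plus a line. In even order the
  canonical embedding \<open>J\<close> is an \<open>A\<close>-bimodule map and the coordinate \<open>\<epsilon>\<close> along the line vanishes
  on \<open>A \<cdot> y\<close> and \<open>y \<cdot> A\<close>. So for a derivation \<open>D\<close> of \<open>A\<^sup>#\<close> the functional \<open>a \<mapsto> \<epsilon> (D a)\<close> vanishes on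
  products, hence on \<open>A\<close> because \<open>A\<^sup>2\<close> is dense, and \<open>D\<close> restricted to \<open>A\<close> is \<open>J\<close> after a derivation
  into the dual of \<open>A\<close>, which is inner. As \<open>D\<close> kills the identity, \<open>D\<close> is inner with the image
  of the same element.
\<close>

section \<open>Seminormed spaces\<close>

text \<open>The record contains no zero vector, so the neutral element is expressed as
  \<open>vscale X 0 y\<close> for any \<open>y\<close> of the carrier, and negatives as multiples by
  -1.\<close>

locale seminormed_space =
  fixes X :: "('x, 'm) lcs_scheme"
  assumes add_closed: "\<lbrakk>x \<in> vcarrier X; y \<in> vcarrier X\<rbrakk> \<Longrightarrow> vadd X x y \<in> vcarrier X"
    and scale_closed: "x \<in> vcarrier X \<Longrightarrow> vscale X s x \<in> vcarrier X"
    and add_assoc: "\<lbrakk>x \<in> vcarrier X; y \<in> vcarrier X; z \<in> vcarrier X\<rbrakk> \<Longrightarrow>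
      vadd X (vadd X x y) z = vadd X x (vadd X y z)"
    and add_commute: "\<lbrakk>x \<in> vcarrier X; y \<in> vcarrier X\<rbrakk> \<Longrightarrow> vadd X x y = vadd X y x"
    and add_zero: "\<lbrakk>x \<in> vcarrier X; y \<in> vcarrier X\<rbrakk> \<Longrightarrow> vadd X x (vscale X 0 y) = x"
    and scale_add: "\<lbrakk>x \<in> vcarrier X; y \<in> vcarrier X\<rbrakk> \<Longrightarrow>
      vscale X s (vadd X x y) = vadd X (vscale X s x) (vscale X s y)"
    and add_scale: "x \<in> vcarrier X \<Longrightarrow> vscale X (s + t) x = vadd X (vscale X s x) (vscale X t x)"
    and scale_scale: "x \<in> vcarrier X \<Longrightarrow> vscale X s (vscale X t x) = vscale X (s * t) x"
    and scale_one: "x \<in> vcarrier X \<Longrightarrow> vscale X 1 x = x"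
    and seminorm_triangle: "\<lbrakk>p \<in> seminorms X; x \<in> vcarrier X; y \<in> vcarrier X\<rbrakk> \<Longrightarrow>
      p (vadd X x y) \<le> p x + p y"
    and seminorm_scale: "\<lbrakk>p \<in> seminorms X; x \<in> vcarrier X\<rbrakk> \<Longrightarrow> p (vscale X s x) = cmod s * p x"
begin

lemma diff_closed: "\<lbrakk>x \<in> vcarrier X; y \<in> vcarrier X\<rbrakk> \<Longrightarrow> vdiff X x y \<in> vcarrier X"
  by (simp add: vdiff_def add_closed scale_closed)

lemma diff_self: "x \<in> vcarrier X \<Longrightarrow> vdiff X x x = vscale X 0 x"
  using add_scale[of x 1 "-1"] by (simp add: vdiff_def scale_one)

lemma add_left_commute:
  "\<lbrakk>x \<in> vcarrier X; y \<in> vcarrier X; z \<in> vcarrier X\<rbrakk> \<Longrightarrow>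
    vadd X x (vadd X y z) = vadd X y (vadd X x z)"
  using add_assoc add_commute by metis

lemma add_diff_swap:
  assumes "x \<in> vcarrier X" "x' \<in> vcarrier X" "y \<in> vcarrier X" "y' \<in> vcarrier X"
  shows "vdiff X (vadd X x y) (vadd X x' y') = vadd X (vdiff X x x') (vdiff X y y')"
  using assms by (simp add: vdiff_def scale_add add_assoc add_left_commute add_closed scale_closed)

lemma diff_add_diff:
  assumes "x \<in> vcarrier X" "y \<in> vcarrier X" "z \<in> vcarrier X"
  shows "vadd X (vdiff X x y) (vdiff X y z) = vdiff X x z"
proof -
  have "vadd X (vdiff X x y) (vdiff X y z) = vadd X (vdiff X x z) (vdiff X y y)"
    using assms by (simp add: vdiff_def add_assoc add_left_commute add_commute add_closed scale_closed)
  then show ?thesis using assms by (simp add: diff_self add_zero diff_closed)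
qed

text \<open>Subtract \<open>x\<close> from both sides. It serves to show that a derivation kills the
  identity.\<close>

lemma idempotent_zero:
  assumes "x \<in> vcarrier X" "vadd X x x = x"
  shows "x = vscale X 0 x"
  using assms diff_self[of x] add_assoc[of x x "vscale X (-1) x"] add_zero[of x x]
  by (simp add: vdiff_def scale_closed)

text \<open>The zero vector is \<open>x\<close> plus its negative, so 0 is at most twice
  \<open>p x\<close>.\<close>

lemma seminorm_nonneg:
  assumes "p \<in> seminorms X" "x \<in> vcarrier X"
  shows "0 \<le> p x"
  using seminorm_triangle[OF assms(1), of x "vscale X (-1) x"] diff_self[of x]
    seminorm_scale[OF assms, of 0] seminorm_scale[OF assms, of "-1"] assms
  by (simp add: vdiff_def scale_closed)

lemma seminorm_diff_triangle:
  assumes "p \<in> seminorms X" "x \<in> vcarrier X" "y \<in> vcarrier X" "z \<in> vcarrier X"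
  shows "p (vdiff X x z) \<le> p (vdiff X x y) + p (vdiff X y z)"
  using seminorm_triangle[OF assms(1), of "vdiff X x y" "vdiff X y z"] assms
  by (simp add: diff_add_diff diff_closed)

lemma topspace_lc_topology: "topspace (lc_topology X) = vcarrier X"
  unfolding lc_topology_def topology_generated_by_topspace by auto

end

text \<open>
  The functions bounded on \<^term>\<open>vcarrier X\<close> by a finite combination of seminorms: for seminorms
  this is continuity.
\<close>

inductive dominated :: "('x, 'm) lcs_scheme \<Rightarrow> ('x \<Rightarrow> real) \<Rightarrow> bool" for X where
  zero: "dominated X (\<lambda>x. 0)"
| seminorm: "\<lbrakk>p \<in> seminorms X; 0 \<le> C\<rbrakk> \<Longrightarrow> dominated X (\<lambda>x. C * p x)"
| add: "\<lbrakk>dominated X q; dominated X r\<rbrakk> \<Longrightarrow> dominated X (\<lambda>x. q x + r x)"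
| mono: "\<lbrakk>dominated X r; \<And>x. x \<in> vcarrier X \<Longrightarrow> q x \<le> r x\<rbrakk> \<Longrightarrow> dominated X q"

lemma dominated_seminorm: "p \<in> seminorms X \<Longrightarrow> dominated X p"
  using dominated.seminorm[of p X 1] by simp

lemma dominated_by_seminorm:
  "\<lbrakk>p \<in> seminorms X; 0 \<le> C; \<And>x. q x \<le> C * p x\<rbrakk> \<Longrightarrow> dominated X q"
  by (rule dominated.mono[OF dominated.seminorm])

lemma dominated_scale:
  assumes "dominated X r" "0 \<le> C"
  shows "dominated X (\<lambda>x. C * r x)"
  using assms(1)
proof induction
  case zero
  then show ?case by (simp add: dominated.zero)
next
  case (seminorm p C')
  then show ?case using dominated.seminorm[of p X "C * C'"] assms(2) by (simp add: mult.assoc)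
next
  case (add q r)
  then show ?case using dominated.add by (simp add: distrib_left)
next
  case (mono r q)
  then show ?case using assms(2) by (intro dominated.mono[OF mono.IH]) (simp add: mult_left_mono)
qed

text \<open>Upper bounds pass through every rule generating \<open>dominated\<close>. For the
  modulus of a continuous functional this makes the suprema defining the strong topology
  finite.\<close>

lemma bdd_above_image_dominated:
  assumes "dominated X r" "bounded_in X S"
  shows "bdd_above (r ` S)"
  using assms(1)
proof induction
  case zero
  then show ?case by (auto intro: bdd_aboveI)
next
  case (seminorm p C)
  then obtain M where "\<And>x. x \<in> S \<Longrightarrow> p x \<le> M"
    using assms(2) unfolding bounded_in_def bdd_above_def by fast
  then show ?case using seminorm by (intro bdd_aboveI2[of _ _ "C * M"]) (simp add: mult_left_mono)
next
  case (add q r)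
  then obtain M N where "\<And>x. x \<in> S \<Longrightarrow> q x \<le> M" "\<And>x. x \<in> S \<Longrightarrow> r x \<le> N"
    by (auto simp: bdd_above_def)
  then show ?case by (intro bdd_aboveI2[of _ _ "M + N"]) (simp add: add_mono)
next
  case (mono r q)
  then obtain M where "\<And>x. x \<in> S \<Longrightarrow> r x \<le> M"
    by (auto simp: bdd_above_def)
  then show ?case using mono.hyps assms(2)
    by (intro bdd_aboveI2[of _ _ M]) (force simp: bounded_in_def)
qed

section \<open>Continuity of linear functionals as domination by seminorms\<close>

context seminormed_space
begin

lemma dominated_neighbourhood:
  assumes "dominated X r" "x0 \<in> vcarrier X" "0 < e"
  shows "\<exists>U. openin (lc_topology X) U \<and> x0 \<in> U \<and> (\<forall>x\<in>U. r (vdiff X x x0) < e)"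
  using assms(1,3)
proof (induction arbitrary: e)
  case zero
  then show ?case
    using assms(2) topspace_lc_topology by (intro exI[of _ "vcarrier X"]) (metis openin_topspace)
next
  case (seminorm p C)
  let ?U = "{y \<in> vcarrier X. p (vdiff X y x0) < e / (C + 1)}"
  \<comment> \<open>Dividing by \<open>C + 1\<close> rather than \<open>C\<close> covers the case
    that \<open>C\<close> is 0.\<close>
  have pos: "e / (C + 1) > 0" using seminorm by simp
  have "openin (lc_topology X) ?U"
    unfolding lc_topology_def
    by (rule topology_generated_by_Basis) (use seminorm assms(2) pos in blast)
  moreover have "x0 \<in> ?U"
    using assms(2) seminorm_scale[OF seminorm(1) assms(2), of 0] pos by (simp add: diff_self)
  moreover have "C * p (vdiff X x x0) < e" if "x \<in> ?U" for x
  proof -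
    have nonneg: "0 \<le> p (vdiff X x x0)"
      using that assms(2) seminorm(1) by (simp add: seminorm_nonneg diff_closed)
    have "p (vdiff X x x0) * (C + 1) < e"
      using that seminorm(2) by (simp add: pos_less_divide_eq)
    then show ?thesis using nonneg by (simp add: algebra_simps)
  qed
  ultimately show ?case by blast
next
  case (add q r)
  obtain U where "openin (lc_topology X) U" "x0 \<in> U" "\<And>x. x \<in> U \<Longrightarrow> q (vdiff X x x0) < e / 2"
    using add.IH(1)[of "e / 2"] add.prems by auto
  moreover obtain V where "openin (lc_topology X) V" "x0 \<in> V"
    "\<And>x. x \<in> V \<Longrightarrow> r (vdiff X x x0) < e / 2"
    using add.IH(2)[of "e / 2"] add.prems by auto
  ultimately show ?case
    by (intro exI[of _ "U \<inter> V"]) (force simp: openin_Int)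
next
  case (mono r q)
  obtain U where U: "openin (lc_topology X) U" "x0 \<in> U" "\<And>x. x \<in> U \<Longrightarrow> r (vdiff X x x0) < e"
    using mono.IH[OF mono.prems] by auto
  have "q (vdiff X x x0) < e" if "x \<in> U" for x
  proof -
    have "x \<in> vcarrier X" using openin_subset[OF U(1)] that by (auto simp: topspace_lc_topology)
    then show ?thesis using mono.hyps(2) U(3)[OF that] assms(2) by (meson diff_closed le_less_trans)
  qed
  then show ?case using U by blast
qed

text \<open>Induction over the generation of the topology: intersections add the dominated
  functions, unions keep the one of a member containing zero. Homogeneity is carried along so that
  vectors can later be rescaled into the unit ball of \<open>r\<close>.\<close>

lemma open_neighbourhood_of_zero:
  assumes "openin (lc_topology X) U" "x0 \<in> vcarrier X" "vscale X 0 x0 \<in> U"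
  shows "\<exists>r. dominated X r \<and> (\<forall>x\<in>vcarrier X. \<forall>t>0. r (vscale X (of_real t) x) = t * r x) \<and>
    (\<forall>x\<in>vcarrier X. 0 \<le> r x) \<and> {x \<in> vcarrier X. r x < 1} \<subseteq> U"
  using assms(1) assms(3) unfolding lc_topology_def openin_topology_generated_by_iff
proof induction
  case Empty
  then show ?case by simp
next
  case (Int U V)
  then obtain q r where
    "dominated X q" "\<forall>x\<in>vcarrier X. \<forall>t>0. q (vscale X (of_real t) x) = t * q x"
    "\<forall>x\<in>vcarrier X. 0 \<le> q x" "{x \<in> vcarrier X. q x < 1} \<subseteq> U"
    "dominated X r" "\<forall>x\<in>vcarrier X. \<forall>t>0. r (vscale X (of_real t) x) = t * r x"
    "\<forall>x\<in>vcarrier X. 0 \<le> r x" "{x \<in> vcarrier X. r x < 1} \<subseteq> V" by auto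
  then show ?case
    by (intro exI[of _ "\<lambda>x. q x + r x"]) (force simp: dominated.add distrib_left)
next
  case (UN K)
  then obtain k where "k \<in> K" "vscale X 0 x0 \<in> k" by blast
  then show ?case using UN.IH[of k] by (meson Union_upper subset_trans)
next
  case (Basis U)
  then consider "U = vcarrier X" | p y e where "U = {x \<in> vcarrier X. p (vdiff X x y) < e}"
    "p \<in> seminorms X" "y \<in> vcarrier X" "e > 0" by auto
  then show ?case
  proof cases
    case 1
    then show ?thesis by (intro exI[of _ "\<lambda>x. 0"]) (auto simp: dominated.zero)
  next
    case 2
    have py: "p (vdiff X (vscale X 0 x0) y) = p y"
      using seminorm_scale[OF 2(2,3), of "-1"] add_zero[of "vscale X (-1) y" x0]
        add_commute[of "vscale X (-1) y" "vscale X 0 x0"] 2 assms(2)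
      by (simp add: vdiff_def scale_closed)
    \<comment> \<open>The distance from zero to the centre \<open>y\<close> is \<open>p y\<close>,
      so \<open>d\<close> is the room left between zero and the boundary of the ball.\<close>
    define d where "d = e - p y"
    have d: "d > 0" using Basis.prems py 2 by (simp add: d_def)
    have "p (vdiff X x y) < e" if "x \<in> vcarrier X" "inverse d * p x < 1" for x
    proof -
      have "p (vdiff X x y) \<le> p x + p y"
        using seminorm_triangle[OF 2(2) that(1), of "vscale X (-1) y"] 2
          seminorm_scale[OF 2(2,3), of "-1"] by (simp add: vdiff_def scale_closed)
      moreover have "p x < d" using that(2) d by (simp add: field_simps)
      ultimately show ?thesis by (simp add: d_def)
    qed
    then show ?thesis using 2 d
      by (intro exI[of _ "\<lambda>x. inverse d * p x"])
        (auto simp: dominated.seminorm seminorm_scale seminorm_nonneg)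
  qed
qed

text \<open>For linear functionals, continuity at zero gives a bound by homogeneity, and a bound
  gives continuity everywhere by translation. From here on membership in the dual is checked through
  seminorms.\<close>

lemma continuous_dual_iff:
  "f \<in> continuous_dual X \<longleftrightarrow>
     (\<forall>x\<in>vcarrier X. \<forall>y\<in>vcarrier X. f (vadd X x y) = f x + f y) \<and>
     (\<forall>s. \<forall>x\<in>vcarrier X. f (vscale X s x) = s * f x) \<and>
     dominated X (\<lambda>x. cmod (f x)) \<and> (\<forall>x. x \<notin> vcarrier X \<longrightarrow> f x = 0)"
proof -
  have "continuous_map (lc_topology X) euclidean f \<longleftrightarrow> dominated X (\<lambda>x. cmod (f x))"
    if add: "\<And>x y. \<lbrakk>x \<in> vcarrier X; y \<in> vcarrier X\<rbrakk> \<Longrightarrow> f (vadd X x y) = f x + f y"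
      and scale: "\<And>s x. x \<in> vcarrier X \<Longrightarrow> f (vscale X s x) = s * f x"
  proof
    assume cont: "continuous_map (lc_topology X) euclidean f"
    show "dominated X (\<lambda>x. cmod (f x))"
    proof (cases "vcarrier X = {}")
      \<comment> \<open>An empty carrier offers no zero vector to work around, and domination holds
        vacuously.\<close>
      case True
      then show ?thesis by (intro dominated.mono[OF dominated.zero]) simp
    next
      case False
      then obtain x0 where x0: "x0 \<in> vcarrier X" by blast
      let ?U = "{x \<in> topspace (lc_topology X). f x \<in> ball 0 1}"
      have U: "openin (lc_topology X) ?U"
        using cont by (rule openin_continuous_map_preimage) simp
      have "vscale X 0 x0 \<in> ?U" using x0 by (simp add: topspace_lc_topology scale_closed scale)
      then obtain r where r: "dominated X r"
        "\<forall>x\<in>vcarrier X. \<forall>t>0. r (vscale X (of_real t) x) = t * r x"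
        "\<forall>x\<in>vcarrier X. 0 \<le> r x" "{x \<in> vcarrier X. r x < 1} \<subseteq> ?U"
        using open_neighbourhood_of_zero[OF U x0] by blast
      \<comment> \<open>For each \<open>t > r x\<close> the vector \<open>x\<close> divided by
        \<open>t\<close> lies in the unit ball of \<open>r\<close>, where \<open>f\<close> has
        modulus below 1. Passing through all such \<open>t\<close> avoids dividing by
        \<open>r x\<close>, which may vanish.\<close>
      have "cmod (f x) \<le> r x" if x: "x \<in> vcarrier X" for x
      proof (rule dense_ge)
        fix t assume t: "r x < t"
        then have pos: "0 < t" using r(3) x by force
        have "r (vscale X (of_real (inverse t)) x) = inverse t * r x"
          using r(2) x pos by (simp del: of_real_inverse)
        also have "\<dots> < 1" using t pos by (simp add: field_simps)
        finally have "r (vscale X (of_real (inverse t)) x) < 1" .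
        then have "vscale X (of_real (inverse t)) x \<in> ?U" 
          using x by (intro subsetD[OF r(4)]) (simp add: scale_closed)
        then have "cmod (of_real (inverse t) * f x) < 1"
          using x by (simp add: scale del: of_real_inverse)
        then have "inverse t * cmod (f x) < 1"
          using pos by (simp only: norm_mult norm_of_real abs_of_pos positive_imp_inverse_positive)
        then show "cmod (f x) \<le> t" using pos by (simp add: field_simps)
      qed
      then show ?thesis by (rule dominated.mono[OF r(1)])
    qed
  next
    assume dom: "dominated X (\<lambda>x. cmod (f x))"
    have "\<exists>T. openin (lc_topology X) T \<and> x \<in> T \<and> T \<subseteq> {x \<in> vcarrier X. f x \<in> U}"
      if "open U" and x: "x \<in> vcarrier X" "f x \<in> U" for U x
    proof -
      obtain e where e: "e > 0" "ball (f x) e \<subseteq> U" 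
        using \<open>open U\<close> x(2) by (auto simp: open_contains_ball)
      obtain T where T: "openin (lc_topology X) T" "x \<in> T" "\<forall>y\<in>T. cmod (f (vdiff X y x)) < e"
        using dominated_neighbourhood[OF dom x(1) e(1)] by blast
      have "y \<in> vcarrier X \<and> f y \<in> U" if y: "y \<in> T" for y
      proof
        show carrier: "y \<in> vcarrier X"
          using openin_subset[OF T(1)] y by (auto simp: topspace_lc_topology)
        have "f (vdiff X y x) = f y - f x"
          using carrier x(1) by (simp add: vdiff_def add scale scale_closed)
        then have "f y \<in> ball (f x) e"
          using T(3)[rule_format, OF y] by (simp add: dist_norm norm_minus_commute)
        then show "f y \<in> U" using e(2) by blast
      qed
      then show ?thesis using T(1,2) by blast
    qed
    then have "openin (lc_topology X) {x \<in> vcarrier X. f x \<in> U}" if "open U" for U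
      using that openin_subopen[of "lc_topology X" "{x \<in> vcarrier X. f x \<in> U}"] by simp
    then show "continuous_map (lc_topology X) euclidean f"
      by (simp add: continuous_map_def topspace_lc_topology)
  qed
  then show ?thesis
    unfolding continuous_dual_def mem_Collect_eq by (intro conj_cong refl) blast+
qed

end

section \<open>Continuous linear maps and adjoints\<close>

text \<open>Continuity is encoded as domination of the pulled-back seminorms, a form that composes
  and passes to adjoints without mention of open sets; \<open>bounded_linear_map_continuous\<close>
  returns to the topologies.\<close>

definition bounded_linear_map ::
  "('x, 'm) lcs_scheme \<Rightarrow> ('y, 'n) lcs_scheme \<Rightarrow> ('x \<Rightarrow> 'y) \<Rightarrow> bool" where
  "bounded_linear_map X Y T \<longleftrightarrow>
     (\<forall>x\<in>vcarrier X. T x \<in> vcarrier Y) \<and>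
     (\<forall>x\<in>vcarrier X. \<forall>y\<in>vcarrier X. T (vadd X x y) = vadd Y (T x) (T y)) \<and>
     (\<forall>s. \<forall>x\<in>vcarrier X. T (vscale X s x) = vscale Y s (T x)) \<and>
     (\<forall>q\<in>seminorms Y. dominated X (\<lambda>x. q (T x)))"

lemma bounded_linear_mapD:
  assumes "bounded_linear_map X Y T"
  shows "x \<in> vcarrier X \<Longrightarrow> T x \<in> vcarrier Y"
    and "\<lbrakk>x \<in> vcarrier X; y \<in> vcarrier X\<rbrakk> \<Longrightarrow> T (vadd X x y) = vadd Y (T x) (T y)"
    and "x \<in> vcarrier X \<Longrightarrow> T (vscale X s x) = vscale Y s (T x)"
    and "q \<in> seminorms Y \<Longrightarrow> dominated X (\<lambda>x. q (T x))"
  using assms by (auto simp: bounded_linear_map_def)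

lemma dominated_comp:
  assumes T: "bounded_linear_map X Y T" and "dominated Y r"
  shows "dominated X (\<lambda>x. r (T x))"
  using assms(2)
proof induction
  case zero
  then show ?case by (rule dominated.zero)
next
  case (seminorm p C)
  then show ?case using dominated_scale[OF bounded_linear_mapD(4)[OF T]] by blast
next
  case (add q r)
  then show ?case by (intro dominated.add)
next
  case (mono r q)
  then show ?case using bounded_linear_mapD(1)[OF T] by (intro dominated.mono[OF mono.IH]) blast
qed

lemma bounded_linear_map_comp:
  assumes "bounded_linear_map X Y T" "bounded_linear_map Y Z S"
  shows "bounded_linear_map X Z (\<lambda>x. S (T x))"
  unfolding bounded_linear_map_def
  using bounded_linear_mapD(1-3)[OF assms(1)] bounded_linear_mapD(1-3)[OF assms(2)]
    dominated_comp[OF assms(1) bounded_linear_mapD(4)[OF assms(2)]]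
  by simp

text \<open>A seminorm of \<open>Y\<close> pulled back along \<open>T\<close> is dominated on
  \<open>X\<close>, hence bounded on \<open>S\<close>. This is what makes adjoints continuous for
  the strong topologies.\<close>

lemma bounded_in_image:
  assumes "bounded_linear_map X Y T" "bounded_in X S"
  shows "bounded_in Y (T ` S)"
  using assms(2) bounded_linear_mapD(1)[OF assms(1)]
    bdd_above_image_dominated[OF bounded_linear_mapD(4)[OF assms(1)] assms(2)]
  by (auto simp: bounded_in_def image_image)

lemma bounded_linear_map_continuous:
  assumes "seminormed_space X" "seminormed_space Y" and T: "bounded_linear_map X Y T"
  shows "continuous_map (lc_topology X) (lc_topology Y) T"
proof -
  interpret X: seminormed_space X by fact
  interpret Y: seminormed_space Y by fact
  note TD = bounded_linear_mapD[OF T]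
  \<comment> \<open>Around a point \<open>x\<close> of the preimage, domination provides a
    neighbourhood on which \<open>T\<close> moves by less than the slack
    \<open>e - q (vdiff Y (T x) y)\<close>.\<close>
  have ball: "openin (lc_topology X) {x \<in> vcarrier X. q (vdiff Y (T x) y) < e}"
    if q: "q \<in> seminorms Y" and y: "y \<in> vcarrier Y" for q y e
  proof (subst openin_subopen, intro ballI)
    fix x assume "x \<in> {x \<in> vcarrier X. q (vdiff Y (T x) y) < e}"
    then have x: "x \<in> vcarrier X" "q (vdiff Y (T x) y) < e" by auto
    obtain U where U: "openin (lc_topology X) U" "x \<in> U"
      "\<And>z. z \<in> U \<Longrightarrow> q (T (vdiff X z x)) < e - q (vdiff Y (T x) y)"
      using X.dominated_neighbourhood[OF TD(4)[OF q] x(1), of "e - q (vdiff Y (T x) y)"] x(2)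
      by auto
    have "z \<in> vcarrier X \<and> q (vdiff Y (T z) y) < e" if "z \<in> U" for z
    proof
      show z: "z \<in> vcarrier X"
        using openin_subset[OF U(1)] that by (auto simp: X.topspace_lc_topology)
      have "T (vdiff X z x) = vdiff Y (T z) (T x)"
        using z x(1) by (simp add: vdiff_def TD X.scale_closed)
      then show "q (vdiff Y (T z) y) < e"
        using U(3)[OF that] Y.seminorm_diff_triangle[OF q TD(1)[OF z] TD(1)[OF x(1)] y] by simp
    qed
    then show "\<exists>U. openin (lc_topology X) U \<and> x \<in> U \<and>
        U \<subseteq> {x \<in> vcarrier X. q (vdiff Y (T x) y) < e}"
      using U by blast
  qed
  have carrier: "openin (lc_topology X) (vcarrier X)"
    using openin_topspace[of "lc_topology X"] by (simp add: X.topspace_lc_topology)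
  have preimage_carrier: "T -` vcarrier Y \<inter> vcarrier X = vcarrier X"
    using TD(1) by auto
  have preimage_ball: "T -` {y \<in> vcarrier Y. p (vdiff Y y x) < e} \<inter> vcarrier X
      = {z \<in> vcarrier X. p (vdiff Y (T z) x) < e}" for p x and e :: real
    using TD(1) by auto
  show ?thesis
    unfolding lc_topology_def[of Y]
  proof (rule continuous_on_generated_topo, goal_cases)
    case (1 U)
    then show ?case
      using ball carrier by (auto simp: X.topspace_lc_topology preimage_carrier preimage_ball
          simp del: vimage_Collect_eq)
  next
    case 2
    then show ?case using TD(1) by (auto simp: X.topspace_lc_topology)
  qed
qed

section \<open>Strong duals, adjoints and evaluations\<close>

lemma strong_dual_simps [simp]:
  "vcarrier (strong_dual X) = continuous_dual X"
  "vadd (strong_dual X) f g = (\<lambda>x. f x + g x)"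
  "vscale (strong_dual X) s f = (\<lambda>x. s * f x)"
  "seminorms (strong_dual X) = {(\<lambda>f. SUP x\<in>S. cmod (f x)) | S. bounded_in X S \<and> S \<noteq> {}}"
  "lact (strong_dual X) b f = (\<lambda>x. if x \<in> vcarrier X then f (ract X x b) else 0)"
  "ract (strong_dual X) f b = (\<lambda>x. if x \<in> vcarrier X then f (lact X b x) else 0)"
  by (simp_all add: strong_dual_def)

lemma continuous_dualD:
  assumes "f \<in> continuous_dual X"
  shows "\<lbrakk>x \<in> vcarrier X; y \<in> vcarrier X\<rbrakk> \<Longrightarrow> f (vadd X x y) = f x + f y"
    and "x \<in> vcarrier X \<Longrightarrow> f (vscale X s x) = s * f x"
    and "continuous_map (lc_topology X) euclidean f"
    and "x \<notin> vcarrier X \<Longrightarrow> f x = 0"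
  using assms by (auto simp: continuous_dual_def)

lemma (in seminormed_space) dominated_continuous_dual:
  "f \<in> continuous_dual X \<Longrightarrow> dominated X (\<lambda>x. cmod (f x))"
  by (simp add: continuous_dual_iff)

lemma (in seminormed_space) continuous_dual_add:
  assumes f: "f \<in> continuous_dual X" and g: "g \<in> continuous_dual X"
  shows "(\<lambda>x. f x + g x) \<in> continuous_dual X"
proof -
  have "dominated X (\<lambda>x. cmod (f x + g x))"
    by (rule dominated.mono[OF dominated.add[OF dominated_continuous_dual[OF f]
          dominated_continuous_dual[OF g]]]) (rule norm_triangle_ineq)
  then show ?thesis
    using continuous_dualD[OF f] continuous_dualD[OF g]
    by (simp add: continuous_dual_iff distrib_left)
qed

lemma (in seminormed_space) continuous_dual_scale:
  assumes f: "f \<in> continuous_dual X"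
  shows "(\<lambda>x. s * f x) \<in> continuous_dual X"
  using continuous_dualD[OF f] dominated_scale[OF dominated_continuous_dual[OF f], of "cmod s"]
  by (simp add: continuous_dual_iff distrib_left norm_mult)

lemma seminormed_space_strong_dual:
  fixes X' :: "('b, 'x) bimodule"
  assumes "seminormed_space X'"
  shows "seminormed_space (strong_dual X')"
proof -
  interpret X': seminormed_space X' by fact
  have triangle: "(SUP x\<in>S. cmod (f x + g x)) \<le> (SUP x\<in>S. cmod (f x)) + (SUP x\<in>S. cmod (g x))"
    if S: "bounded_in X' S" "S \<noteq> {}" and fg: "f \<in> continuous_dual X'" "g \<in> continuous_dual X'"
    for S f g
  proof (rule cSUP_least[OF S(2)])
    fix x assume "x \<in> S"
    then have "cmod (f x) \<le> (SUP x\<in>S. cmod (f x))" "cmod (g x) \<le> (SUP x\<in>S. cmod (g x))"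
      using bdd_above_image_dominated[OF X'.dominated_continuous_dual S(1)] fg
      by (auto intro: cSUP_upper)
    then show "cmod (f x + g x) \<le> (SUP x\<in>S. cmod (f x)) + (SUP x\<in>S. cmod (g x))"
      using norm_triangle_ineq[of "f x" "g x"] by linarith
  qed
  have scale: "(SUP x\<in>S. cmod (s * f x)) = cmod s * (SUP x\<in>S. cmod (f x))"
    if S: "bounded_in X' S" "S \<noteq> {}" and f: "f \<in> continuous_dual X'" for S f s
  proof -
    \<comment> \<open>Multiplication by \<open>cmod s\<close> is monotone and continuous, so it
      commutes with the supremum of a nonempty bounded set.\<close>
    have "continuous (at_left m) (\<lambda>t. cmod s * t)" for m
      by (intro continuous_intros)
    then show ?thesis
      using continuous_at_Sup_mono[of "\<lambda>t. cmod s * t" "(\<lambda>x. cmod (f x)) ` S"] S(2)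
        bdd_above_image_dominated[OF X'.dominated_continuous_dual[OF f] S(1)]
      by (simp add: monoI mult_left_mono image_image norm_mult)
  qed
  show ?thesis
  proof
    fix p f assume "p \<in> seminorms (strong_dual X')" "f \<in> vcarrier (strong_dual X')"
    then obtain S where S: "bounded_in X' S" "S \<noteq> {}" "p = (\<lambda>f. SUP x\<in>S. cmod (f x))"
      and f: "f \<in> continuous_dual X'"
      by auto
    show "p (vscale (strong_dual X') s f) = cmod s * p f" for s
      using scale[OF S(1,2) f] by (simp add: S(3))
    show "p (vadd (strong_dual X') f g) \<le> p f + p g" if "g \<in> vcarrier (strong_dual X')" for g
      using triangle[OF S(1,2) f] that by (simp add: S(3))
  qed (simp_all add: X'.continuous_dual_add X'.continuous_dual_scale algebra_simps)
qed

text \<open>The transpose of \<open>T\<close>, cut off to 0 outside the carrier because elements of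
  \<open>continuous_dual\<close> vanish there.\<close>

definition adjoint :: "('x, 'm) lcs_scheme \<Rightarrow> ('x \<Rightarrow> 'y) \<Rightarrow> ('y \<Rightarrow> complex) \<Rightarrow> 'x \<Rightarrow> complex" where
  "adjoint X T f = (\<lambda>x. if x \<in> vcarrier X then f (T x) else 0)"

lemma adjoint_in_dual:
  assumes "seminormed_space X" "seminormed_space Y"
    and T: "bounded_linear_map X Y T" and f: "f \<in> continuous_dual Y"
  shows "adjoint X T f \<in> continuous_dual X"
proof -
  interpret X: seminormed_space X by fact
  interpret Y: seminormed_space Y by fact
  have "dominated X (\<lambda>x. cmod (f (T x)))"
    using dominated_comp[OF T Y.dominated_continuous_dual[OF f]] by simp
  then have "dominated X (\<lambda>x. cmod (adjoint X T f x))"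
    by (rule dominated.mono) (simp add: adjoint_def)
  then show ?thesis
    using bounded_linear_mapD(1-3)[OF T] continuous_dualD[OF f]
    by (simp add: X.continuous_dual_iff) (simp add: adjoint_def X.add_closed X.scale_closed)
qed

lemma bounded_linear_map_adjoint:
  fixes X :: "('b, 'x) bimodule" and Y :: "('d, 'y) bimodule"
  assumes "seminormed_space X" "seminormed_space Y" and T: "bounded_linear_map X Y T"
  shows "bounded_linear_map (strong_dual Y) (strong_dual X) (adjoint X T)"
proof -
  have "dominated (strong_dual Y) (\<lambda>f. SUP x\<in>S. cmod (adjoint X T f x))"
    if S: "bounded_in X S" "S \<noteq> {}" for S
  proof -
    have "(\<lambda>x. cmod (adjoint X T f x)) ` S = (\<lambda>y. cmod (f y)) ` T ` S" for f
      using S(1) by (auto simp: adjoint_def bounded_in_def image_image intro!: image_cong)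
    then show ?thesis
      using bounded_in_image[OF T S(1)] S(2) by (auto intro!: dominated_seminorm)
  qed
  then show ?thesis
    unfolding bounded_linear_map_def
    using adjoint_in_dual[OF assms] by (intro conjI) (auto simp: adjoint_def[of X T])
qed

text \<open>Extended by \<open>0\<close> off the dual, as \<^const>\<open>continuous_dual\<close> requires.\<close>

definition evaluation :: "('x, 'm) lcs_scheme \<Rightarrow> 'x \<Rightarrow> ('x \<Rightarrow> complex) \<Rightarrow> complex" where
  "evaluation X x f = (if f \<in> continuous_dual X then f x else 0)"

text \<open>A singleton is bounded, so the modulus of the value at \<open>x\<close> is one of the
  seminorms of the strong dual.\<close>

lemma evaluation_in_dual:
  fixes X :: "('b, 'x) bimodule"
  assumes "seminormed_space X" "x \<in> vcarrier X"
  shows "evaluation X x \<in> continuous_dual (strong_dual X)"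
proof -
  interpret X: seminormed_space X by fact
  interpret X': seminormed_space "strong_dual X"
    by (rule seminormed_space_strong_dual) fact
  have "bounded_in X {x}" using assms(2) by (simp add: bounded_in_def)
  then have "(\<lambda>f. SUP y\<in>{x}. cmod (f y)) \<in> seminorms (strong_dual X)"
    unfolding strong_dual_simps mem_Collect_eq by (intro exI[of _ "{x}"]) simp
  then have "dominated (strong_dual X) (\<lambda>f. cmod (f x))"
    using dominated_seminorm by fastforce
  then have "dominated (strong_dual X) (\<lambda>f. cmod (evaluation X x f))"
    by (rule dominated.mono) (simp add: evaluation_def)
  then show ?thesis
    by (simp add: X'.continuous_dual_iff)
      (simp add: evaluation_def X.continuous_dual_add X.continuous_dual_scale)
qed

section \<open>Copies of a space along an injective map\<close>

lemma transport_simps: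
  assumes "inj_on g (vcarrier X)"
  shows "vcarrier (transport g X) = g ` vcarrier X"
    and "\<lbrakk>x \<in> vcarrier X; y \<in> vcarrier X\<rbrakk> \<Longrightarrow> vadd (transport g X) (g x) (g y) = g (vadd X x y)"
    and "x \<in> vcarrier X \<Longrightarrow> vscale (transport g X) s (g x) = g (vscale X s x)"
    and "seminorms (transport g X) = (\<lambda>p. p \<circ> inv_into (vcarrier X) g) ` seminorms X"
    and "x \<in> vcarrier X \<Longrightarrow> lact (transport g X) b (g x) = g (lact X b x)"
    and "x \<in> vcarrier X \<Longrightarrow> ract (transport g X) (g x) b = g (ract X x b)"
  using assms by (simp_all add: transport_def Let_def)

lemma seminormed_space_transport:
  assumes "seminormed_space X" and g: "inj_on g (vcarrier X)"
  shows "seminormed_space (transport g X)"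
proof -
  interpret X: seminormed_space X by fact
  show ?thesis
  proof
    show "vadd (transport g X) x y = vadd (transport g X) y x"
      if "x \<in> vcarrier (transport g X)" "y \<in> vcarrier (transport g X)" for x y
      using that X.add_commute by (auto simp: transport_simps[OF g])
  qed (auto simp: transport_simps[OF g] g X.add_closed X.scale_closed X.add_assoc X.add_zero
      X.scale_add X.add_scale X.scale_scale X.scale_one X.seminorm_triangle X.seminorm_scale)
qed

text \<open>Together with \<open>bounded_linear_map_inv_transport\<close> this makes
  \<open>g\<close> a topological isomorphism onto the copy, so continuous maps can be conjugated by
  it.\<close>

lemma bounded_linear_map_transport:
  assumes g: "inj_on g (vcarrier X)"
  shows "bounded_linear_map X (transport g X) g"
  unfolding bounded_linear_map_def
  by (auto simp: transport_simps[OF g] g intro: dominated.mono[OF dominated_seminorm])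

lemma bounded_linear_map_inv_transport:
  assumes "seminormed_space X" and g: "inj_on g (vcarrier X)"
  shows "bounded_linear_map (transport g X) X (inv_into (vcarrier X) g)"
proof -
  interpret X: seminormed_space X by fact
  have "dominated (transport g X) (\<lambda>x. p (inv_into (vcarrier X) g x))" if "p \<in> seminorms X" for p
    using that dominated_seminorm[of "p \<circ> inv_into (vcarrier X) g" "transport g X"]
    by (simp add: transport_simps[OF g] comp_def)
  then show ?thesis
    unfolding bounded_linear_map_def
    by (auto simp: transport_simps[OF g] g X.add_closed X.scale_closed)
qed

section \<open>Comparing the iterated duals of an algebra and of its unitization\<close>

text \<open>Continuity is asked of the action of each single algebra element: such maps have
  adjoints, and the dual actions are these adjoints.\<close>

locale continuous_bimodule = seminormed_space X for X :: "('b, 'x) bimodule" +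
  assumes lact_bounded: "bounded_linear_map X X (lact X b)"
    and ract_bounded: "bounded_linear_map X X (\<lambda>x. ract X x b)"

lemmas (in continuous_bimodule) lact_simps = bounded_linear_mapD(1-3)[OF lact_bounded]
lemmas (in continuous_bimodule) ract_simps = bounded_linear_mapD(1-3)[OF ract_bounded]

lemma lact_strong_dual: "lact (strong_dual X) b = adjoint X (\<lambda>x. ract X x b)"
  and ract_strong_dual: "(\<lambda>f. ract (strong_dual X) f b) = adjoint X (lact X b)"
  by (simp_all add: adjoint_def fun_eq_iff)

text \<open>The actions on the dual are adjoints of the original ones with left and right exchanged,
  and adjoints are continuous.\<close>

lemma continuous_bimodule_strong_dual:
  assumes "continuous_bimodule X"
  shows "continuous_bimodule (strong_dual X)"
proof -
  interpret X: continuous_bimodule X by fact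
  interpret X': seminormed_space "strong_dual X"
    by (rule seminormed_space_strong_dual) unfold_locales
  show ?thesis
    by unfold_locales
      (unfold lact_strong_dual ract_strong_dual,
       (rule bounded_linear_map_adjoint, unfold_locales, rule X.ract_bounded X.lact_bounded)+)
qed

lemma bounded_linear_map_cong:
  assumes "bounded_linear_map X Y T" "seminormed_space X"
    and "\<And>x. x \<in> vcarrier X \<Longrightarrow> T x = T' x"
  shows "bounded_linear_map X Y T'"
proof -
  interpret X: seminormed_space X by fact
  have "dominated X (\<lambda>x. q (T' x))" if "q \<in> seminorms Y" for q
    by (rule dominated.mono[OF bounded_linear_mapD(4)[OF assms(1) that]]) (simp add: assms(3))
  then show ?thesis
    using bounded_linear_mapD(1-3)[OF assms(1)]
    by (simp add: bounded_linear_map_def X.add_closed X.scale_closed flip: assms(3))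
qed

lemma continuous_bimodule_transport:
  assumes "continuous_bimodule X" and g: "inj_on g (vcarrier X)"
  shows "continuous_bimodule (transport g X)"
proof -
  interpret X: continuous_bimodule X by fact
  interpret X': seminormed_space "transport g X"
    by (rule seminormed_space_transport[OF _ g]) unfold_locales
  have conj: "bounded_linear_map (transport g X) (transport g X)
      (\<lambda>u. g (T (inv_into (vcarrier X) g u)))" if "bounded_linear_map X X T" for T
    by (intro bounded_linear_map_comp[OF bounded_linear_map_inv_transport[OF _ g]]
        bounded_linear_map_comp[OF that] bounded_linear_map_transport g X.seminormed_space_axioms)
  show ?thesis
  proof
    show "bounded_linear_map (transport g X) (transport g X) (lact (transport g X) b)" for b
      by (rule bounded_linear_map_cong[OF conj[OF X.lact_bounded[of b]]])
        (unfold_locales, auto simp: transport_simps[OF g] g)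
    show "bounded_linear_map (transport g X) (transport g X) (\<lambda>u. ract (transport g X) u b)" for b
      by (rule bounded_linear_map_cong[OF conj[OF X.ract_bounded[of b]]])
        (unfold_locales, auto simp: transport_simps[OF g] g)
  qed
qed

text \<open>\<open>Y\<close> consists of the copy of \<open>X\<close> under \<open>J\<close> and the
  line through \<open>e\<close>, with coordinates \<open>P\<close> and \<open>\<epsilon>\<close>.
  The last four assumptions say that \<open>(a, s)\<close> acts as \<open>(a, 0)\<close> plus the
  scalar \<open>s\<close>, and in particular that \<open>(0, 1)\<close> acts as the
  identity.\<close>

locale splitting = X: continuous_bimodule X + Y: continuous_bimodule Y
  for X :: "('a::zero, 'x) bimodule" and Y :: "('a \<times> complex, 'y) bimodule" +
  fixes J :: "'x \<Rightarrow> 'y" and P :: "'y \<Rightarrow> 'x" and \<epsilon> :: "'y \<Rightarrow> complex" and e :: 'y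
  assumes J: "bounded_linear_map X Y J" and P: "bounded_linear_map Y X P"
    and eps: "\<epsilon> \<in> continuous_dual Y" and e: "e \<in> vcarrier Y"
    and PJ: "x \<in> vcarrier X \<Longrightarrow> P (J x) = x"
    and decomp: "y \<in> vcarrier Y \<Longrightarrow> vadd Y (J (P y)) (vscale Y (\<epsilon> y) e) = y"
    and lact_split: "y \<in> vcarrier Y \<Longrightarrow> lact Y (a, s) y = vadd Y (lact Y (a, 0) y) (vscale Y s y)"
    and ract_split: "y \<in> vcarrier Y \<Longrightarrow> ract Y y (a, s) = vadd Y (ract Y y (a, 0)) (vscale Y s y)"
    and lact_zero: "y \<in> vcarrier Y \<Longrightarrow> lact Y (0, 0) y = vscale Y 0 y"
    and ract_zero: "y \<in> vcarrier Y \<Longrightarrow> ract Y y (0, 0) = vscale Y 0 y"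
begin

lemmas J_simps = bounded_linear_mapD(1-3)[OF J]
lemmas P_simps = bounded_linear_mapD(1-3)[OF P]
lemmas eps_simps = continuous_dualD(1,2)[OF eps]

text \<open>Applying a functional \<open>f\<close> to the decomposition of \<open>y\<close> splits
  \<open>f\<close> into a part factoring through \<open>P\<close> and the multiple
  \<open>f e\<close> of \<open>\<epsilon>\<close>. Hence \<open>\<epsilon>\<close> spans the new
  line and evaluation at \<open>e\<close> is the new coordinate.\<close>

lemma strong_dual:
  "splitting (strong_dual X) (strong_dual Y) (adjoint Y P) (adjoint X J) (evaluation Y e) \<epsilon>"
proof -
  interpret X': continuous_bimodule "strong_dual X"
    by (rule continuous_bimodule_strong_dual) unfold_locales
  interpret Y': continuous_bimodule "strong_dual Y"
    by (rule continuous_bimodule_strong_dual) unfold_locales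
  show ?thesis
  proof
    show "bounded_linear_map (strong_dual X) (strong_dual Y) (adjoint Y P)"
      by (rule bounded_linear_map_adjoint[OF _ _ P]) unfold_locales
    show "bounded_linear_map (strong_dual Y) (strong_dual X) (adjoint X J)"
      by (rule bounded_linear_map_adjoint[OF _ _ J]) unfold_locales
    show "evaluation Y e \<in> continuous_dual (strong_dual Y)"
      by (rule evaluation_in_dual[OF _ e]) unfold_locales
    show "\<epsilon> \<in> vcarrier (strong_dual Y)" using eps by simp
  next
    fix f assume "f \<in> vcarrier (strong_dual X)"
    then show "adjoint X J (adjoint Y P f) = f"
      by (auto simp: adjoint_def fun_eq_iff PJ J_simps continuous_dualD(4))
  next
    fix f assume "f \<in> vcarrier (strong_dual Y)"
    then have f: "f \<in> continuous_dual Y" by simp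
    have "f (J (P y)) + f e * \<epsilon> y = f y" if "y \<in> vcarrier Y" for y
    proof -
      have "f y = f (vadd Y (J (P y)) (vscale Y (\<epsilon> y) e))" by (simp add: decomp that)
      also have "\<dots> = f (J (P y)) + f e * \<epsilon> y"
        using continuous_dualD(1,2)[OF f] that e by (simp add: J_simps P_simps Y.scale_closed)
      finally show ?thesis ..
    qed
    then show "vadd (strong_dual Y) (adjoint Y P (adjoint X J f))
        (vscale (strong_dual Y) (evaluation Y e f) \<epsilon>) = f"
      using f continuous_dualD(4)[OF f] continuous_dualD(4)[OF eps]
      by (auto simp: adjoint_def evaluation_def fun_eq_iff P_simps)
    note f_simps = continuous_dualD[OF f]
    show "lact (strong_dual Y) (a, s) f =
        vadd (strong_dual Y) (lact (strong_dual Y) (a, 0) f) (vscale (strong_dual Y) s f)" for a s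
      using f_simps ract_split[of _ a s] by (auto simp: fun_eq_iff Y.ract_simps Y.scale_closed)
    show "ract (strong_dual Y) f (a, s) =
        vadd (strong_dual Y) (ract (strong_dual Y) f (a, 0)) (vscale (strong_dual Y) s f)" for a s
      using f_simps lact_split[of _ a s] by (auto simp: fun_eq_iff Y.lact_simps Y.scale_closed)
    show "lact (strong_dual Y) (0, 0) f = vscale (strong_dual Y) 0 f"
      using f_simps by (auto simp: fun_eq_iff ract_zero)
    show "ract (strong_dual Y) f (0, 0) = vscale (strong_dual Y) 0 f"
      using f_simps by (auto simp: fun_eq_iff lact_zero)
  qed
qed

lemma transport:
  assumes g: "inj_on g (vcarrier X)" and h: "inj_on h (vcarrier Y)"
  defines "g' \<equiv> inv_into (vcarrier X) g" and "h' \<equiv> inv_into (vcarrier Y) h"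
  shows "splitting (transport g X) (transport h Y) (\<lambda>u. h (J (g' u))) (\<lambda>v. g (P (h' v)))
    (adjoint (transport h Y) h' \<epsilon>) (h e)"
proof -
  interpret X': continuous_bimodule "transport g X"
    by (rule continuous_bimodule_transport[OF _ g]) unfold_locales
  interpret Y': continuous_bimodule "transport h Y"
    by (rule continuous_bimodule_transport[OF _ h]) unfold_locales
  note simps = transport_simps[OF g] transport_simps[OF h] g h g'_def h'_def
    J_simps P_simps Y.add_closed Y.scale_closed Y.lact_simps Y.ract_simps e
  show ?thesis
  proof
    show "bounded_linear_map (transport g X) (transport h Y) (\<lambda>u. h (J (g' u)))"
      unfolding g'_def
      by (intro bounded_linear_map_comp[OF bounded_linear_map_inv_transport[OF _ g]]
        bounded_linear_map_comp[OF J] bounded_linear_map_transport h X.seminormed_space_axioms)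
    show "bounded_linear_map (transport h Y) (transport g X) (\<lambda>v. g (P (h' v)))"
      unfolding h'_def
      by (intro bounded_linear_map_comp[OF bounded_linear_map_inv_transport[OF _ h]]
        bounded_linear_map_comp[OF P] bounded_linear_map_transport g Y.seminormed_space_axioms)
    show "adjoint (transport h Y) h' \<epsilon> \<in> continuous_dual (transport h Y)"
      unfolding h'_def
      by (rule adjoint_in_dual[OF _ _ bounded_linear_map_inv_transport[OF _ h] eps]) unfold_locales
  next
    fix v a s assume "v \<in> vcarrier (transport h Y)"
    then obtain y where y: "y \<in> vcarrier Y" "v = h y" by (auto simp: transport_simps[OF h])
    show "lact (transport h Y) (a, s) v =
        vadd (transport h Y) (lact (transport h Y) (a, 0) v) (vscale (transport h Y) s v)"
      using y lact_split[OF y(1), of a s] by (simp add: simps)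
    show "ract (transport h Y) v (a, s) =
        vadd (transport h Y) (ract (transport h Y) v (a, 0)) (vscale (transport h Y) s v)"
      using y ract_split[OF y(1), of a s] by (simp add: simps)
  qed (auto simp: simps adjoint_def PJ decomp lact_zero ract_zero)
qed

end

text \<open>
  Passing to adjoints exchanges \<open>J\<close> with \<open>P\<close> and \<open>\<epsilon>\<close> with \<open>e\<close>, so the compatibility with the
  actions alternates between the two pairs.
\<close>

locale even_splitting = splitting +
  assumes J_lact: "x \<in> vcarrier X \<Longrightarrow> J (lact X a x) = lact Y (a, 0) (J x)"
    and J_ract: "x \<in> vcarrier X \<Longrightarrow> J (ract X x a) = ract Y (J x) (a, 0)"
    and eps_lact: "y \<in> vcarrier Y \<Longrightarrow> \<epsilon> (lact Y (a, 0) y) = 0"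
    and eps_ract: "y \<in> vcarrier Y \<Longrightarrow> \<epsilon> (ract Y y (a, 0)) = 0"

locale odd_splitting = splitting +
  assumes P_lact: "y \<in> vcarrier Y \<Longrightarrow> P (lact Y (a, 0) y) = lact X a (P y)"
    and P_ract: "y \<in> vcarrier Y \<Longrightarrow> P (ract Y y (a, 0)) = ract X (P y) a"
    and e_lact: "lact Y (a, 0) e = vscale Y 0 e"
    and e_ract: "ract Y e (a, 0) = vscale Y 0 e"

text \<open>The adjoint of the bimodule map \<open>J\<close> is a bimodule map. That
  \<open>\<epsilon>\<close> vanishes on products with \<open>(a, 0)\<close> says that the dual
  actions of \<open>(a, 0)\<close> annihilate \<open>\<epsilon>\<close>, the spanning vector of the
  new line.\<close>

lemma (in even_splitting) odd_splitting_strong_dual: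
  "odd_splitting (strong_dual X) (strong_dual Y) (adjoint Y P) (adjoint X J) (evaluation Y e) \<epsilon>"
proof -
  interpret dual: splitting "strong_dual X" "strong_dual Y" "adjoint Y P" "adjoint X J" "evaluation Y e" \<epsilon>
    by (rule strong_dual)
  show ?thesis
    by unfold_locales
      (auto simp: adjoint_def fun_eq_iff J_simps J_lact J_ract X.lact_simps X.ract_simps
        eps_lact eps_ract)
qed

text \<open>The adjoint of the bimodule map \<open>P\<close> is a bimodule map, and a product of
  \<open>(a, 0)\<close> with a functional takes at \<open>e\<close> the value at a product of
  \<open>e\<close> with \<open>(a, 0)\<close>, which is zero.\<close>

lemma (in odd_splitting) even_splitting_strong_dual:
  "even_splitting (strong_dual X) (strong_dual Y) (adjoint Y P) (adjoint X J) (evaluation Y e) \<epsilon>"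
proof -
  interpret dual: splitting "strong_dual X" "strong_dual Y" "adjoint Y P" "adjoint X J" "evaluation Y e" \<epsilon>
    by (rule strong_dual)
  show ?thesis
  proof
    fix f a assume f: "f \<in> vcarrier (strong_dual Y)"
    then have fe: "f (vscale Y 0 e) = 0" using continuous_dualD(2)[of f Y e 0] e by simp
    \<comment> \<open>\<open>evaluation\<close> is the value at \<open>e\<close> only on the dual,
      so the products with \<open>f\<close> have to be known to lie there.\<close>
    have "evaluation Y e k = k e" if "k \<in> vcarrier (strong_dual Y)" for k
      using that by (simp add: evaluation_def)
    then show "evaluation Y e (lact (strong_dual Y) (a, 0) f) = 0"
      "evaluation Y e (ract (strong_dual Y) f (a, 0)) = 0"
      using dual.Y.lact_simps(1)[OF f, of "(a, 0)"] dual.Y.ract_simps(1)[OF f, of "(a, 0)"]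
      by (simp_all add: e e_lact e_ract fe del: strong_dual_simps(1))
  qed (auto simp: adjoint_def fun_eq_iff P_simps P_lact P_ract Y.lact_simps Y.ract_simps)
qed

lemma (in even_splitting) even_splitting_transport:
  assumes g: "inj_on g (vcarrier X)" and h: "inj_on h (vcarrier Y)"
  shows "even_splitting (transport g X) (transport h Y) (\<lambda>u. h (J (inv_into (vcarrier X) g u)))
    (\<lambda>v. g (P (inv_into (vcarrier Y) h v))) (adjoint (transport h Y) (inv_into (vcarrier Y) h) \<epsilon>) (h e)"
proof -
  interpret transport: splitting "transport g X" "transport h Y"
    "\<lambda>u. h (J (inv_into (vcarrier X) g u))" "\<lambda>v. g (P (inv_into (vcarrier Y) h v))"
    "adjoint (transport h Y) (inv_into (vcarrier Y) h) \<epsilon>" "h e"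
    by (rule transport[OF g h])
  show ?thesis
    by unfold_locales
      (auto simp: transport_simps[OF g] transport_simps[OF h] g h adjoint_def J_simps
        J_lact J_ract eps_lact eps_ract X.lact_simps X.ract_simps Y.lact_simps Y.ract_simps
        dest!: inj_onD[OF h])
qed

lemma (in odd_splitting) odd_splitting_transport:
  assumes g: "inj_on g (vcarrier X)" and h: "inj_on h (vcarrier Y)"
  shows "odd_splitting (transport g X) (transport h Y) (\<lambda>u. h (J (inv_into (vcarrier X) g u)))
    (\<lambda>v. g (P (inv_into (vcarrier Y) h v))) (adjoint (transport h Y) (inv_into (vcarrier Y) h) \<epsilon>) (h e)"
proof -
  interpret transport: splitting "transport g X" "transport h Y"
    "\<lambda>u. h (J (inv_into (vcarrier X) g u))" "\<lambda>v. g (P (inv_into (vcarrier Y) h v))"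
    "adjoint (transport h Y) (inv_into (vcarrier Y) h) \<epsilon>" "h e"
    by (rule transport[OF g h])
  show ?thesis
    by unfold_locales
      (auto simp: transport_simps[OF g] transport_simps[OF h] g h e P_simps
        P_lact P_ract e_lact e_ract X.lact_simps X.ract_simps Y.lact_simps Y.ract_simps)
qed

section \<open>The regular bimodules\<close>

lemma regular_bimodule_simps [simp]:
  "vcarrier (regular_bimodule A) = UNIV"
  "vadd (regular_bimodule A) x y = x + y"
  "vscale (regular_bimodule A) s x = scl A s x"
  "seminorms (regular_bimodule A) = range (sn A)"
  "lact (regular_bimodule A) b x = mul A b x"
  "ract (regular_bimodule A) x b = mul A x b"
  by (simp_all add: regular_bimodule_def)

lemma unitization_simps [simp]:
  "scl (unitization A) z (a, s) = (scl A z a, z * s)"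
  "mul (unitization A) (a, s) (b, t) = (mul A a b + scl A t a + scl A s b, s * t)"
  "sn (unitization A) l (a, s) = sn A l a + cmod s"
  by (simp_all add: unitization_def)

lemma continuous_derivationD:
  assumes "continuous_derivation A X D"
  shows "D a \<in> vcarrier X"
    and "D (a + b) = vadd X (D a) (D b)"
    and "D (scl A z a) = vscale X z (D a)"
    and "D (mul A a b) = vadd X (lact X a (D b)) (ract X (D a) b)"
    and "continuous_map (alg_topology A) (lc_topology X) D"
  using assms by (auto simp: continuous_derivation_def)

section \<open>The algebra, its unitization, and derivations into their duals\<close>

context frechet_algebra
begin

lemma sn_nonneg: "0 \<le> sn A l a"
  using sn_triangle[of l a "scl A (-1) a"] sn_scl[of l 0 a] sn_scl[of l "-1" a] by simp

lemma mul_zero [simp]: "mul A 0 a = 0" "mul A a 0 = 0"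
  using mul_scl_left[of 0 a a] mul_scl_right[of a 0 a] by simp_all

lemma seminormed_space_regular: "seminormed_space (regular_bimodule A)"
  by unfold_locales
    (auto simp: scale_right_distrib scale_left_distrib sn_triangle sn_scl ac_simps)

text \<open>By submultiplicativity, multiplication by \<open>b\<close> on either side is bounded
  with constant \<open>sn A l b\<close>.\<close>

lemma continuous_bimodule_regular: "continuous_bimodule (regular_bimodule A)"
proof -
  interpret seminormed_space "regular_bimodule A" by (rule seminormed_space_regular)
  have "sn A l (mul A x b) \<le> sn A l b * sn A l x" for l x b
    using submultiplicative[of l x b] by (simp add: mult.commute)
  then have "dominated (regular_bimodule A) (\<lambda>x. sn A l (mul A b x))"
    "dominated (regular_bimodule A) (\<lambda>x. sn A l (mul A x b))" for l b
    by (intro dominated_by_seminorm[of "sn A l" _ "sn A l b"]; simp add: submultiplicative sn_nonneg)+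
  then show ?thesis
    by unfold_locales
      (auto simp: bounded_linear_map_def mul_add_left mul_add_right mul_scl_left mul_scl_right)
qed

lemma seminormed_space_unitization: "seminormed_space (regular_bimodule (unitization A))"
proof
  fix p and x y :: "'a \<times> complex"
  assume "p \<in> seminorms (regular_bimodule (unitization A))"
  then obtain l where p: "p = sn (unitization A) l" by auto
  obtain a s b t where xy: "x = (a, s)" "y = (b, t)" by (cases x, cases y)
  show "p (vadd (regular_bimodule (unitization A)) x y) \<le> p x + p y"
    using sn_triangle[of l a b] norm_triangle_ineq[of s t] by (simp add: p xy)
qed (auto simp: scale_right_distrib scale_left_distrib sn_scl norm_mult algebra_simps zero_prod_def)

text \<open>The bounds for the three terms of the algebra part, together with the modulus of
  \<open>s * t\<close>, are exactly the four terms of the expanded product of the seminorms.\<close>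

lemma sn_unitization_mul:
  "sn (unitization A) l (mul (unitization A) x y) \<le> sn (unitization A) l x * sn (unitization A) l y"
proof -
  obtain a s b t where xy: "x = (a, s)" "y = (b, t)" by (cases x, cases y)
  have "sn A l (mul A a b + scl A t a + scl A s b) \<le>
      sn A l a * sn A l b + cmod t * sn A l a + cmod s * sn A l b"
    using sn_triangle[of l "mul A a b + scl A t a" "scl A s b"]
      sn_triangle[of l "mul A a b" "scl A t a"] submultiplicative[of l a b]
    by (simp add: sn_scl)
  then show ?thesis by (simp add: xy norm_mult algebra_simps)
qed

lemma continuous_bimodule_unitization: "continuous_bimodule (regular_bimodule (unitization A))"
proof -
  let ?U = "unitization A"
  interpret seminormed_space "regular_bimodule ?U" by (rule seminormed_space_unitization)
  have nonneg: "0 \<le> sn ?U l x" for l x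
    by (cases x) (simp add: sn_nonneg)
  have "sn ?U l (mul ?U x b) \<le> sn ?U l b * sn ?U l x" for l x b
    using sn_unitization_mul[of l x b] by (simp add: mult.commute)
  then have "dominated (regular_bimodule ?U) (\<lambda>x. sn ?U l (mul ?U b x))"
    "dominated (regular_bimodule ?U) (\<lambda>x. sn ?U l (mul ?U x b))" for l b
    by (intro dominated_by_seminorm[of "sn ?U l" _ "sn ?U l b"]; simp add: sn_unitization_mul nonneg)+
  then show ?thesis
    by unfold_locales
      (auto simp: bounded_linear_map_def mul_add_left mul_add_right mul_scl_left mul_scl_right
        scale_right_distrib scale_left_distrib algebra_simps)
qed

lemma bounded_linear_map_unitization:
  "bounded_linear_map (regular_bimodule A) (regular_bimodule (unitization A)) (\<lambda>a. (a, 0))"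
  "bounded_linear_map (regular_bimodule (unitization A)) (regular_bimodule A) fst"
proof -
  show "bounded_linear_map (regular_bimodule A) (regular_bimodule (unitization A)) (\<lambda>a. (a, 0))"
    by (auto simp: bounded_linear_map_def intro: dominated_seminorm)
  have "dominated (regular_bimodule (unitization A)) (\<lambda>x. sn A l (fst x))" for l
    by (rule dominated.mono[OF dominated_seminorm[of "sn (unitization A) l"]]) auto
  then show "bounded_linear_map (regular_bimodule (unitization A)) (regular_bimodule A) fst"
    by (auto simp: bounded_linear_map_def)
qed

text \<open>Order zero: the algebra is an ideal of its unitization, so the scalar coordinate
  vanishes on products with its elements.\<close>

lemma even_splitting_unitization:
  "even_splitting (regular_bimodule A) (regular_bimodule (unitization A)) (\<lambda>a. (a, 0)) fst snd (0, 1)"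
proof -
  let ?U = "regular_bimodule (unitization A)"
  interpret A: continuous_bimodule "regular_bimodule A" by (rule continuous_bimodule_regular)
  interpret U: continuous_bimodule ?U by (rule continuous_bimodule_unitization)
  have "dominated ?U (\<lambda>x. cmod (snd x))"
    by (rule dominated.mono[OF dominated_seminorm[of "sn (unitization A) 0"]])
      (auto simp: sn_nonneg)
  then have "snd \<in> continuous_dual ?U" by (auto simp: U.continuous_dual_iff)
  then show ?thesis
    by unfold_locales (auto simp: bounded_linear_map_unitization)
qed

text \<open>Induction on the order: each step dualises the splitting, which switches its parity, and
  then copies it along the codings.\<close>

lemma splitting_iterated_dual:
  fixes j :: "'a \<Rightarrow> 'u" and j' :: "'a \<times> complex \<Rightarrow> 'v"
  assumes coding: "faithful_coding j c (regular_bimodule A) m"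
    "faithful_coding j' c' (regular_bimodule (unitization A)) m" and "k \<le> m"
  defines "X \<equiv> iterated_dual j c (regular_bimodule A)"
    and "Y \<equiv> iterated_dual j' c' (regular_bimodule (unitization A))"
  shows "if even k then \<exists>J P \<epsilon> e. even_splitting (X k) (Y k) J P \<epsilon> e
    else \<exists>J P \<epsilon> e. odd_splitting (X k) (Y k) J P \<epsilon> e"
  using \<open>k \<le> m\<close>
proof (induction k)
  case 0
  have "even_splitting (X 0) (Y 0) = even_splitting (transport j (regular_bimodule A))
      (transport j' (regular_bimodule (unitization A)))"
    by (simp add: X_def Y_def)
  then show ?case
    using even_splitting.even_splitting_transport[OF even_splitting_unitization, of j j'] coding
    by (auto simp: faithful_coding_def)
next
  case (Suc k)
  \<comment> \<open>Faithfulness covers indices strictly below \<open>m\<close>, and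
    \<open>Suc k \<le> m\<close> puts \<open>k\<close> among them.\<close>
  have inj: "inj_on (c k) (vcarrier (strong_dual (X k)))"
    "inj_on (c' k) (vcarrier (strong_dual (Y k)))"
    using coding Suc.prems by (auto simp: faithful_coding_def X_def Y_def)
  have step: "X (Suc k) = transport (c k) (strong_dual (X k))"
    "Y (Suc k) = transport (c' k) (strong_dual (Y k))"
    by (simp_all add: X_def Y_def)
  show ?case
  proof (cases "even k")
    case True
    then obtain J P \<epsilon> e where "even_splitting (X k) (Y k) J P \<epsilon> e"
      using Suc by auto
    from odd_splitting.odd_splitting_transport[OF even_splitting.odd_splitting_strong_dual[OF this] inj]
    show ?thesis using True by (auto simp: step)
  next
    case False
    then obtain J P \<epsilon> e where "odd_splitting (X k) (Y k) J P \<epsilon> e"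
      using Suc by auto
    from even_splitting.even_splitting_transport[OF odd_splitting.even_splitting_strong_dual[OF this] inj]
    show ?thesis using False by (auto simp: step)
  qed
qed

text \<open>Stated for an arbitrary even splitting, so that the codings and the order of the dual
  drop out of the argument.\<close>

lemma inner_derivation_unitization:
  assumes "even_splitting X Y J P \<epsilon> e"
    and dense: "alg_topology A closure_of (span {mul A a b | a b. True}) = UNIV"
    and inner: "\<And>D. continuous_derivation A X D \<Longrightarrow> inner_derivation X D"
    and D: "continuous_derivation (unitization A) Y D"
  shows "inner_derivation Y D"
proof -
  interpret even_splitting X Y J P \<epsilon> e by fact
  interpret A: seminormed_space "regular_bimodule A" by (rule seminormed_space_regular)
  interpret U: seminormed_space "regular_bimodule (unitization A)"
    by (rule seminormed_space_unitization)
  have D_carrier: "D u \<in> vcarrier Y" and D_add: "D (u + v) = vadd Y (D u) (D v)"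
    and D_scl: "D (scl (unitization A) z u) = vscale Y z (D u)"
    and D_mul: "D (mul (unitization A) u v) = vadd Y (lact Y u (D v)) (ract Y (D u) v)"
    and D_cont: "continuous_map (alg_topology (unitization A)) (lc_topology Y) D" for u v z
    by (rule continuous_derivationD[OF D])+
  have embed: "D (a + b, 0) = vadd Y (D (a, 0)) (D (b, 0))"
    "D (scl A z a, 0) = vscale Y z (D (a, 0))"
    "D (mul A a b, 0) = vadd Y (lact Y (a, 0) (D (b, 0))) (ract Y (D (a, 0)) (b, 0))" for a b z
    using D_add[of "(a, 0)" "(b, 0)"] D_scl[of z "(a, 0)"] D_mul[of "(a, 0)" "(b, 0)"] by simp_all
  have "continuous_map (alg_topology A) (alg_topology (unitization A)) (\<lambda>a. (a, 0))"
    by (rule bounded_linear_map_continuous[OF _ _ bounded_linear_map_unitization(1)]) unfold_locales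
  then have embed_cont: "continuous_map (alg_topology A) (lc_topology Y) (\<lambda>a. D (a, 0))"
    using continuous_map_compose[OF _ D_cont] by (simp add: comp_def)
  define \<tau> where "\<tau> a = \<epsilon> (D (a, 0))" for a
  have "continuous_map (alg_topology A) euclidean \<tau>"
    using continuous_map_compose[OF embed_cont continuous_dualD(3)[OF eps]]
    by (simp add: comp_def \<tau>_def[abs_def])
  \<comment> \<open>The kernel of \<open>\<tau>\<close> is closed. Once it is known to be a subspace
    containing all products, density makes it everything.\<close>
  then have "closedin (alg_topology A) {a \<in> topspace (alg_topology A). \<tau> a \<in> {0}}"
    by (rule closedin_continuous_map_preimage) simp
  then have closed: "closedin (alg_topology A) {a. \<tau> a = 0}"
    by (simp add: A.topspace_lc_topology)
  have \<tau>_scl: "\<tau> (scl A z a) = z * \<tau> a" for z a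
    by (simp add: \<tau>_def embed eps_simps D_carrier)
  have "subspace {a. \<tau> a = 0}"
    using \<tau>_scl[of 0 0] by (simp add: subspace_def \<tau>_scl) (simp add: \<tau>_def embed eps_simps D_carrier)
  \<comment> \<open>The derivation rule writes the value at a product as a left plus a right product
    with elements of the algebra, and \<open>\<epsilon>\<close> kills both.\<close>
  moreover have "{mul A a b | a b. True} \<subseteq> {a. \<tau> a = 0}"
    by (auto simp: \<tau>_def embed eps_simps D_carrier Y.lact_simps Y.ract_simps eps_lact eps_ract)
  ultimately have "span {mul A a b | a b. True} \<subseteq> {a. \<tau> a = 0}"
    by (intro span_minimal)
  then have "\<tau> a = 0" for a
    using closure_of_minimal[OF _ closed] dense by blast
  then have JP: "J (P (D (a, 0))) = D (a, 0)" for a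
    using decomp[OF D_carrier[of "(a, 0)"]] D_carrier[of "(a, 0)"] e
    by (simp add: \<tau>_def Y.add_zero J_simps P_simps)
  define D1 where "D1 a = P (D (a, 0))" for a
  have J_D1: "D (a, 0) = J (D1 a)" and D1_carrier: "D1 a \<in> vcarrier X" for a
    by (simp_all add: D1_def JP P_simps D_carrier)
  \<comment> \<open>Compatibility with the actions is available for \<open>J\<close>, not for
    \<open>P\<close>. The rule is therefore verified after applying \<open>J\<close>, and
    \<open>P\<close> then cancels \<open>J\<close>.\<close>
  have "D1 (mul A a b) = vadd X (lact X a (D1 b)) (ract X (D1 a) b)" for a b
  proof -
    have "J (vadd X (lact X a (D1 b)) (ract X (D1 a) b)) = D (mul A a b, 0)"
      unfolding embed(3) by (simp add: J_D1 D1_carrier J_simps J_lact J_ract X.lact_simps X.ract_simps)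
    then have "P (J (vadd X (lact X a (D1 b)) (ract X (D1 a) b))) = D1 (mul A a b)"
      by (simp add: D1_def)
    then show ?thesis
      by (simp add: PJ D1_carrier X.add_closed X.lact_simps X.ract_simps)
  qed
  moreover have "continuous_map (alg_topology A) (lc_topology X) D1"
    using continuous_map_compose[OF embed_cont bounded_linear_map_continuous[OF _ _ P]]
      X.seminormed_space_axioms Y.seminormed_space_axioms
    by (simp add: comp_def D1_def[abs_def])
  ultimately have "continuous_derivation A X D1"
    using D1_carrier by (auto simp: continuous_derivation_def D1_def embed P_simps D_carrier)
  then obtain x where x: "x \<in> vcarrier X" "\<And>a. D1 a = vdiff X (lact X a x) (ract X x a)"
    using inner by (auto simp: inner_derivation_def)
  have Jx: "J x \<in> vcarrier Y" using x(1) by (rule J_simps)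
  \<comment> \<open>The identity acts trivially on both sides, so its square being itself forces its
    derivative to equal its own double.\<close>
  have D_unit: "D (0, 1) = vscale Y 0 (D (0, 1))"
  proof (rule Y.idempotent_zero[OF D_carrier])
    have "lact Y (0, 1) y = y" "ract Y y (0, 1) = y" if "y \<in> vcarrier Y" for y
      using lact_split[OF that, of 0 1] ract_split[OF that, of 0 1] that
        Y.add_commute[of y "vscale Y 0 y"]
      by (simp_all add: lact_zero ract_zero Y.scale_one Y.scale_closed Y.add_zero)
    then show "vadd Y (D (0, 1)) (D (0, 1)) = D (0, 1)"
      using D_mul[of "(0, 1)" "(0, 1)"] by (simp add: D_carrier)
  qed
  have "D (a, s) = vdiff Y (lact Y (a, s) (J x)) (ract Y (J x) (a, s))" for a s
  proof -
    have "D (a, s) = vadd Y (D (a, 0)) (vscale Y s (D (0, 1)))"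
      \<comment> \<open>The summand \<open>(0, s)\<close> is written as \<open>s\<close> times the
        identity to bring in homogeneity.\<close>
      using D_add[of "(a, 0)" "scl (unitization A) s (0, 1)"]
      by (simp only: D_scl) simp
    also have "\<dots> = D (a, 0)"
      by (subst D_unit) (simp add: D_carrier Y.scale_scale Y.add_zero)
    also have "\<dots> = vdiff Y (lact Y (a, 0) (J x)) (ract Y (J x) (a, 0))"
      using x by (simp add: J_D1 vdiff_def J_simps J_lact J_ract X.lact_simps X.ract_simps X.scale_closed)
    \<comment> \<open>The scalar \<open>s\<close> contributes the same multiple of
      \<open>J x\<close> to both products, and the difference cancels it.\<close>
    also have "\<dots> = vdiff Y (lact Y (a, s) (J x)) (ract Y (J x) (a, s))"
      unfolding lact_split[OF Jx, of a s] ract_split[OF Jx, of a s]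
      using Jx by (simp add: Y.add_diff_swap Y.diff_self Y.add_zero Y.diff_closed Y.scale_closed
          Y.scale_scale Y.lact_simps Y.ract_simps)
    finally show ?thesis .
  qed
  then show ?thesis using Jx by (auto simp: inner_derivation_def)
qed

end

theorem theorem3p16:
  fixes A :: "'a::ab_group_add seminormed_algebra"
    and n :: nat
    and j :: "'a \<Rightarrow> 'u" and c :: "nat \<Rightarrow> ('u \<Rightarrow> complex) \<Rightarrow> 'u"
    and j' :: "'a \<times> complex \<Rightarrow> 'v" and c' :: "nat \<Rightarrow> ('v \<Rightarrow> complex) \<Rightarrow> 'v"
  assumes "frechet_algebra A"
    and "self_induced A"
    and "n \<ge> 1"
    and "faithful_coding j c (regular_bimodule A) (2 * n)"
    and "faithful_coding j' c' (regular_bimodule (unitization A)) (2 * n)"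
    and "weakly_amenable j c (2 * n) A"
  shows "weakly_amenable j' c' (2 * n) (unitization A)"
proof -
  interpret frechet_algebra A by fact
  let ?X = "iterated_dual j c (regular_bimodule A) (2 * n)"
  let ?Y = "iterated_dual j' c' (regular_bimodule (unitization A)) (2 * n)"
  obtain J P \<epsilon> e where split: "even_splitting ?X ?Y J P \<epsilon> e"
    using splitting_iterated_dual[OF assms(4,5) order_refl] by auto
  show ?thesis
    unfolding weakly_amenable_def
  proof (intro allI impI)
    fix D assume D: "continuous_derivation (unitization A) ?Y D"
    show "inner_derivation ?Y D"
      by (rule inner_derivation_unitization[OF split _ _ D])
        (use assms(2,6) in \<open>auto simp: self_induced_def weakly_amenable_def\<close>)
  qed
qed

end
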